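(* Let $f=(f_1,\dots,f_n):\mathbb{R}^n\to\mathbb{R}^n$ be a real polynomial mapping. Suppose that at least one of $f$, $f^{\infty}$ is copositive, and that $\mathrm{Sol}(f^{\infty})=\{0\}$. Then the following statements hold: (a) There exists a generic set $\mathcal{O}$ in $\mathbb{R}^n$ such that $\mathrm{CP}(f+a)$ is $\mathcal{D}_0$ for every $a\in\mathcal{O}$. (b) For every $\mu>0$ there exists $\varepsilon>0$ such that $\mathrm{Sol}(f+a)$ is nonempty and $$\mathrm{Sol}(f+a)\subseteq\mathrm{Sol}(f)+\mathbb{B}(0,\mu)$$ for every $a\in\mathbb{R}^n$ satisfying $\|a\|<\varepsilon$.
   Context: For a real polynomial mapping $g=(g_1,\dots,g_n):\mathbb{R}^n\to\mathbb{R}^n$, $\mathrm{CP}(g)$ is the polynomial complementarity problem of finding $x\in\mathbb{R}^n$ with $x\ge0$, $g(x)\ge0$ (componentwise) and $\langle x\mid g(x)\rangle=0$ (usual scalar product), and $\mathrm{Sol}(g)$ is its solution set. The problem $\mathrm{CP}(g)$ (or $g$) is called $\mathcal{D}_0$ if the set $\{x\in\mathbb{C}^n:x_1g_1(x)=\dots=x_ng_n(x)=0\}$ is finite. $g$ is copositive if $\langle\alpha\mid g(\alpha)\rangle\ge0$ for all $\alpha\in\mathbb{R}^n_+$ (the non-negative orthant). If $d=\deg g=\max_i\deg g_i$, then $g^{\infty}=(g_1^\infty,\dots,g_n^\infty)$, where $g_i^\infty$ is the homogeneous component of degree $d$ of $g_i$. A subset $\mathcal{O}\subset\mathbb{R}^m$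 is generic if $\mathbb{R}^m\setminus\mathcal{O}$ has Lebesgue measure zero. $\|\cdot\|$ is the Euclidean norm, $\mathbb{B}(0,\mu)$ is the ball in $\mathbb{R}^n$ with center $0$ and radius $\mu$ (whether open or closed is immaterial), $+$ between sets is the Minkowski sum, and $f+a$ is the mapping $x\mapsto f(x)+a$. *)

theory Defs
  imports "HOL-Analysis.Analysis" "HOL-Library.Poly_Mapping" "HOL-Library.Set_Algebras"
begin

text \<open>
  A real polynomial in the indeterminates indexed by \<^typ>\<open>'n\<close> is a finitely supported function
  from monomials (exponent vectors) to coefficients. Polynomial mappings are kept as formal
  objects, because they have to be evaluated at real as well as at complex points.
\<close>

type_synonym 'n monomial = "'n \<Rightarrow>\<^sub>0 nat"

type_synonym 'n rpoly = "'n monomial \<Rightarrow>\<^sub>0 real"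

type_synonym 'n polymap = "('n rpoly) ^ 'n"

definition monom_degree :: "('n::finite) monomial \<Rightarrow> nat" where
  "monom_degree m = (\<Sum>i\<in>UNIV. Poly_Mapping.lookup m i)"

definition poly_eval :: "('n::finite) rpoly \<Rightarrow> ('a::{real_algebra_1, comm_ring_1}) ^ 'n \<Rightarrow> 'a" where
  "poly_eval p x =
     (\<Sum>m\<in>Poly_Mapping.keys p.
        of_real (Poly_Mapping.lookup p m) * (\<Prod>i\<in>UNIV. (x $ i) ^ Poly_Mapping.lookup m i))"

definition map_eval :: "('n::finite) polymap \<Rightarrow> ('a::{real_algebra_1, comm_ring_1}) ^ 'n \<Rightarrow> 'a ^ 'n" where
  "map_eval g x = (\<chi> i. poly_eval (g $ i) x)"

text \<open>The zero polynomial gets degree 0; this does not affect the maximum in \<open>map_degree\<close>.\<close>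

definition poly_degree :: "('n::finite) rpoly \<Rightarrow> nat" where
  "poly_degree p = Max (insert 0 (monom_degree ` Poly_Mapping.keys p))"

definition map_degree :: "('n::finite) polymap \<Rightarrow> nat" where
  "map_degree g = Max (range (\<lambda>i. poly_degree (g $ i)))"

definition hom_component :: "nat \<Rightarrow> ('n::finite) rpoly \<Rightarrow> 'n rpoly" where
  "hom_component d p =
     (\<Sum>m\<in>{m \<in> Poly_Mapping.keys p. monom_degree m = d}.
        Poly_Mapping.single m (Poly_Mapping.lookup p m))"

text \<open>
  The degree is the common degree of the mapping, not that of the individual components,
  so components of smaller degree contribute 0.
\<close>

definition leading_map :: "('n::finite) polymap \<Rightarrow> 'n polymap" where
  "leading_map g = (\<chi> i. hom_component (map_degree g) (g $ i))"

definition const_map :: "real ^ ('n::finite) \<Rightarrow> 'n polymap" where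
  "const_map a = (\<chi> i. Poly_Mapping.single 0 (a $ i))"

definition nonneg_orthant :: "(real ^ ('n::finite)) set" where
  "nonneg_orthant = {x. \<forall>i. 0 \<le> x $ i}"

definition Sol :: "('n::finite) polymap \<Rightarrow> (real ^ 'n) set" where
  "Sol g = {x. x \<in> nonneg_orthant \<and> map_eval g x \<in> nonneg_orthant \<and> x \<bullet> map_eval g x = 0}"

definition copositive :: "('n::finite) polymap \<Rightarrow> bool" where
  "copositive g \<longleftrightarrow> (\<forall>\<alpha>\<in>nonneg_orthant. 0 \<le> \<alpha> \<bullet> map_eval g \<alpha>)"

definition D0 :: "('n::finite) polymap \<Rightarrow> bool" where
  "D0 g \<longleftrightarrow> finite {x :: complex ^ 'n. \<forall>i. x $ i * (map_eval g x) $ i = 0}"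

definition generic :: "(real ^ ('n::finite)) set \<Rightarrow> bool" where
  "generic A \<longleftrightarrow> - A \<in> null_sets lebesgue"

end

theory Submission
  imports Defs "HOL-Computational_Algebra.Polynomial"
begin

text \<open>
  The two parts have independent proofs.

  Finiteness for generic translations comes from counting dimensions, in place of Sard's theorem or
  elimination theory. On the subspace \<open>\<complex>\<^sup>J\<close> of vectors supported in \<open>J\<close>, the coordinate
  \<open>x\<^sub>j\<close> and the components \<open>f\<^sub>i\<close> with \<open>i \<in> J\<close> are one more polynomial than there are variables,
  hence algebraically dependent
  (\<open>box_polynomials_algebraically_dependent\<close>). If \<open>f\<^sub>i(x) = -a\<^sub>i\<close> for all \<open>i \<in> J\<close>, the relation
  becomes a polynomial equation for the single number \<open>x\<^sub>j\<close>. It is trivial only for \<open>a\<close> in the zero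
  set of a nonzero polynomial, and such a set is null
  (\<open>null_zero_set_of_nonzero_polynomial\<close>). The union of these null sets over the finitely many pairs
  \<open>(J, j)\<close> is the exceptional set.

  Stability of the solution set is a compactness argument. Copositivity of \<open>f\<close> passes to \<open>f\<^sup>\<infinity>\<close>, so
  \<open>f\<^sup>\<infinity>\<close> may be assumed copositive. On the orthant truncated by \<open>\<Sum>x\<^sub>i \<le> r\<close> Brouwer's theorem
  provides a solution of the complementarity problem with a multiplier \<open>\<tau> \<ge> 0\<close> for the truncating
  constraint. Solutions of this kind, for all small \<open>a\<close>, satisfy a common bound \<open>\<Sum>x\<^sub>i \<le> R\<close>:
  an unbounded family, rescaled to \<open>\<Sum>x\<^sub>i = 1\<close>, would accumulate at a nonzero element of
  \<open>Sol f\<^sup>\<infinity>\<close> (\<open>perturbed_multiplier_solutions_bounded\<close>). For \<open>r > R\<close> the constraint is therefore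
  inactive and \<open>Sol (f + a)\<close> is nonempty. The same bound keeps all these solution sets in one compact
  set, and by continuity of \<open>f\<close> they can only accumulate at \<open>Sol f\<close> as \<open>a\<close> tends to zero.
\<close>

section \<open>Evaluation of formal polynomials\<close>

lemma poly_eval_superset:
  assumes "finite S" and "Poly_Mapping.keys p \<subseteq> S"
  shows "poly_eval p x =
     (\<Sum>m\<in>S. of_real (Poly_Mapping.lookup p m) * (\<Prod>i\<in>UNIV. (x $ i) ^ Poly_Mapping.lookup m i))"
  unfolding poly_eval_def
  by (rule sum.mono_neutral_left) (use assms in \<open>auto simp: in_keys_iff\<close>)

lemma poly_eval_add: "poly_eval (p + q) x = poly_eval p x + poly_eval q x"
proof -
  let ?S = "Poly_Mapping.keys p \<union> Poly_Mapping.keys q"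
  have "finite ?S" by simp
  then show ?thesis
    by (subst (1 2 3) poly_eval_superset[where S = ?S])
      (use Poly_Mapping.keys_add[of p q] in
        \<open>auto simp: lookup_add distrib_right sum.distrib\<close>)
qed

lemma poly_eval_const: "poly_eval (Poly_Mapping.single 0 c) x = of_real c"
  by (subst poly_eval_superset[where S = "{0}"]) auto

lemma map_eval_add_const: "map_eval (f + const_map a) x $ i = map_eval f x $ i + of_real (a $ i)"
  by (simp add: map_eval_def const_map_def poly_eval_add poly_eval_const)

section \<open>Algebraic dependence by counting dimensions\<close>

text \<open>
  More vectors than coordinates are linearly dependent; here \<open>M a\<close> is the coordinate vector of the
  \<open>a\<close>-th vector. The induction on the coordinates is Gaussian elimination. Indexing the vectors
  by \<open>A\<close>, instead of collecting them in a set, makes repeated vectors harmless.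
\<close>

lemma nontrivial_linear_relation:
  fixes M :: "'a \<Rightarrow> 'b \<Rightarrow> 'c::field"
  assumes "finite B" and "finite A" and "card B < card A"
  shows "\<exists>c. (\<exists>a\<in>A. c a \<noteq> 0) \<and> (\<forall>b\<in>B. (\<Sum>a\<in>A. c a * M a b) = 0)"
  using assms
proof (induction B arbitrary: A M rule: finite_induct)
  case empty
  then have "A \<noteq> {}" by auto
  then show ?case by (intro exI[of _ "\<lambda>_. 1"]) auto
next
  case (insert b B)
  show ?case
  proof (cases "\<forall>a\<in>A. M a b = 0")
    case True
    have "card B < card A" using insert by simp
    from insert.IH[OF insert.prems(1) this] obtain c where
      "\<exists>a\<in>A. c a \<noteq> 0" "\<forall>b\<in>B. (\<Sum>a\<in>A. c a * M a b) = 0" by blast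
    with True show ?thesis by (intro exI[of _ c]) auto
  next
    case False
    then obtain a0 where a0: "a0 \<in> A" "M a0 b \<noteq> 0" by blast
    let ?A = "A - {a0}"
    define M' where "M' a b' = M a b' - M a b / M a0 b * M a0 b'" for a b'
    have "card B < card ?A" "finite ?A" using insert a0 by auto
    from insert.IH[OF this(2,1), of M'] obtain c where
      c: "\<exists>a\<in>?A. c a \<noteq> 0" "\<forall>b\<in>B. (\<Sum>a\<in>?A. c a * M' a b) = 0" by blast
    define c' where "c' a = (if a = a0 then - (\<Sum>a\<in>?A. c a * M a b) / M a0 b else c a)" for a
    have split: "(\<Sum>a\<in>A. c' a * M a b') =
        - (\<Sum>a\<in>?A. c a * M a b) / M a0 b * M a0 b' + (\<Sum>a\<in>?A. c a * M a b')" for b'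
    proof -
      have "(\<Sum>a\<in>A. c' a * M a b') = c' a0 * M a0 b' + (\<Sum>a\<in>?A. c' a * M a b')"
        using insert.prems a0 by (simp add: sum.remove)
      also have "(\<Sum>a\<in>?A. c' a * M a b') = (\<Sum>a\<in>?A. c a * M a b')"
        by (rule sum.cong) (auto simp: c'_def)
      finally show ?thesis by (simp add: c'_def)
    qed
    have "(\<Sum>a\<in>A. c' a * M a b') = 0" if "b' \<in> insert b B" for b'
    proof (cases "b' = b")
      case True
      then show ?thesis using a0 by (simp add: split)
    next
      case False
      then have "0 = (\<Sum>a\<in>?A. c a * M' a b')" using c(2) that by simp
      also have "\<dots> = (\<Sum>a\<in>?A. c a * M a b' - c a * M a b * (M a0 b' / M a0 b))"
        by (simp add: M'_def algebra_simps)
      also have "\<dots> = (\<Sum>a\<in>?A. c a * M a b') - (\<Sum>a\<in>?A. c a * M a b) * (M a0 b' / M a0 b)"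
        by (simp only: sum_subtractf sum_distrib_right)
      finally show ?thesis by (simp add: split)
    qed
    moreover have "\<exists>a\<in>A. c' a \<noteq> 0"
      using c(1) by (auto simp: c'_def)
    ultimately show ?thesis by blast
  qed
qed

text \<open>
  Polynomial functions on the coordinate subspace \<open>\<complex>\<^sup>J\<close>, with the degree bounded by \<open>K\<close> in
  each variable separately: these exponent vectors form a box, which is easy to count. The function
  \<open>h\<close> is arbitrary outside the subspace, so the maps need not be restricted beforehand.
\<close>

definition box_polynomial :: "'n::finite set \<Rightarrow> nat \<Rightarrow> (complex ^ 'n \<Rightarrow> complex) \<Rightarrow> bool" where
  "box_polynomial J K h \<longleftrightarrow>
     (\<exists>c. \<forall>x. (\<forall>i. i \<notin> J \<longrightarrow> x $ i = 0) \<longrightarrow>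
        h x = (\<Sum>\<beta>\<in>PiE J (\<lambda>_. {..K}). c \<beta> * (\<Prod>i\<in>J. x $ i ^ \<beta> i)))"

lemma box_polynomial_cong:
  assumes "box_polynomial J K h"
    and "\<And>x. \<forall>i. i \<notin> J \<longrightarrow> x $ i = 0 \<Longrightarrow> h' x = h x"
  shows "box_polynomial J K h'"
  using assms unfolding box_polynomial_def by simp

lemma box_polynomial_monomial:
  assumes "\<And>i. i \<in> J \<Longrightarrow> \<beta> i \<le> K"
  shows "box_polynomial J K (\<lambda>x. \<Prod>i\<in>J. x $ i ^ \<beta> i)"
proof -
  let ?B = "PiE J (\<lambda>_. {..K})"
  have "(\<Prod>i\<in>J. x $ i ^ \<beta> i) =
      (\<Sum>\<gamma>\<in>?B. (if \<gamma> = restrict \<beta> J then 1 else 0) * (\<Prod>i\<in>J. x $ i ^ \<gamma> i))" for x :: "complex ^ 'a"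
  proof -
    have "(\<Sum>\<gamma>\<in>?B. (if \<gamma> = restrict \<beta> J then 1 else 0) * (\<Prod>i\<in>J. x $ i ^ \<gamma> i)) =
        (\<Sum>\<gamma>\<in>?B. if \<gamma> = restrict \<beta> J then (\<Prod>i\<in>J. x $ i ^ \<gamma> i) else 0)"
      by (rule sum.cong) auto
    also have "\<dots> = (\<Prod>i\<in>J. x $ i ^ restrict \<beta> J i)"
      using assms by (subst sum.delta) (auto simp: finite_PiE)
    finally show ?thesis by simp
  qed
  then show ?thesis unfolding box_polynomial_def
    by (intro exI[of _ "\<lambda>\<gamma>. if \<gamma> = restrict \<beta> J then 1 else 0"]) simp
qed

lemma box_polynomial_cmult:
  assumes "box_polynomial J K h"
  shows "box_polynomial J K (\<lambda>x. a * h x)"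
proof -
  obtain c where "\<forall>x. (\<forall>i. i \<notin> J \<longrightarrow> x $ i = 0) \<longrightarrow>
        h x = (\<Sum>\<beta>\<in>PiE J (\<lambda>_. {..K}). c \<beta> * (\<Prod>i\<in>J. x $ i ^ \<beta> i))"
    using assms unfolding box_polynomial_def by blast
  then show ?thesis unfolding box_polynomial_def
    by (intro exI[of _ "\<lambda>\<beta>. a * c \<beta>"]) (simp add: sum_distrib_left mult.assoc)
qed

lemma box_polynomial_sum:
  fixes h :: "'s \<Rightarrow> complex ^ 'n::finite \<Rightarrow> complex"
  assumes "\<And>s. s \<in> S \<Longrightarrow> box_polynomial J K (h s)"
  shows "box_polynomial J K (\<lambda>x. \<Sum>s\<in>S. h s x)"
proof -
  have "\<forall>s\<in>S. \<exists>c. \<forall>x. (\<forall>i. i \<notin> J \<longrightarrow> x $ i = 0) \<longrightarrow>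
        h s x = (\<Sum>\<beta>\<in>PiE J (\<lambda>_. {..K}). c \<beta> * (\<Prod>i\<in>J. x $ i ^ \<beta> i))"
    using assms unfolding box_polynomial_def by blast
  from bchoice[OF this] obtain c where c: "\<forall>s\<in>S. \<forall>x. (\<forall>i. i \<notin> J \<longrightarrow> x $ i = 0) \<longrightarrow>
        h s x = (\<Sum>\<beta>\<in>PiE J (\<lambda>_. {..K}). c s \<beta> * (\<Prod>i\<in>J. x $ i ^ \<beta> i))" ..
  show ?thesis unfolding box_polynomial_def
  proof (intro exI[of _ "\<lambda>\<beta>. \<Sum>s\<in>S. c s \<beta>"] allI impI)
    fix x :: "complex ^ 'n" assume x: "\<forall>i. i \<notin> J \<longrightarrow> x $ i = 0"
    have "(\<Sum>s\<in>S. h s x) = (\<Sum>s\<in>S. \<Sum>\<beta>\<in>PiE J (\<lambda>_. {..K}). c s \<beta> * (\<Prod>i\<in>J. x $ i ^ \<beta> i))"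
      using c x by (intro sum.cong) auto
    also have "\<dots> = (\<Sum>\<beta>\<in>PiE J (\<lambda>_. {..K}). \<Sum>s\<in>S. c s \<beta> * (\<Prod>i\<in>J. x $ i ^ \<beta> i))"
      by (rule sum.swap)
    finally show "(\<Sum>s\<in>S. h s x) =
        (\<Sum>\<beta>\<in>PiE J (\<lambda>_. {..K}). (\<Sum>s\<in>S. c s \<beta>) * (\<Prod>i\<in>J. x $ i ^ \<beta> i))"
      by (simp add: sum_distrib_right)
  qed
qed

lemma box_polynomial_mult:
  fixes h g :: "complex ^ 'n::finite \<Rightarrow> complex"
  assumes "box_polynomial J K h" and "box_polynomial J L g"
  shows "box_polynomial J (K + L) (\<lambda>x. h x * g x)"
proof -
  obtain c where c: "\<And>x. (\<forall>i. i \<notin> J \<longrightarrow> x $ i = 0) \<Longrightarrow>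
        h x = (\<Sum>\<beta>\<in>PiE J (\<lambda>_. {..K}). c \<beta> * (\<Prod>i\<in>J. x $ i ^ \<beta> i))"
    using assms(1) unfolding box_polynomial_def by blast
  obtain d where d: "\<And>x. (\<forall>i. i \<notin> J \<longrightarrow> x $ i = 0) \<Longrightarrow>
        g x = (\<Sum>\<beta>\<in>PiE J (\<lambda>_. {..L}). d \<beta> * (\<Prod>i\<in>J. x $ i ^ \<beta> i))"
    using assms(2) unfolding box_polynomial_def by blast
  have "box_polynomial J (K + L) (\<lambda>x. \<Sum>\<beta>\<in>PiE J (\<lambda>_. {..K}). \<Sum>\<gamma>\<in>PiE J (\<lambda>_. {..L}).
      (c \<beta> * d \<gamma>) * (\<Prod>i\<in>J. x $ i ^ (\<beta> i + \<gamma> i)))"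
    by (intro box_polynomial_sum box_polynomial_cmult box_polynomial_monomial)
       (auto simp: PiE_iff intro!: add_mono)
  then show ?thesis
  proof (rule box_polynomial_cong)
    fix x :: "complex ^ 'n" assume x: "\<forall>i. i \<notin> J \<longrightarrow> x $ i = 0"
    show "h x * g x = (\<Sum>\<beta>\<in>PiE J (\<lambda>_. {..K}). \<Sum>\<gamma>\<in>PiE J (\<lambda>_. {..L}).
      (c \<beta> * d \<gamma>) * (\<Prod>i\<in>J. x $ i ^ (\<beta> i + \<gamma> i)))"
      by (simp add: c[OF x] d[OF x] sum_product power_add prod.distrib mult_ac)
  qed
qed

lemma box_polynomial_mono:
  assumes "box_polynomial J K h" and "K \<le> L"
  shows "box_polynomial J L h"
proof -
  have "box_polynomial J (K + (L - K)) (\<lambda>x. h x * (\<Prod>i\<in>J. x $ i ^ 0))"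
    by (intro box_polynomial_mult box_polynomial_monomial assms) auto
  then show ?thesis using assms(2) by simp
qed

lemma box_polynomial_one: "box_polynomial J 0 (\<lambda>x. 1)"
  using box_polynomial_monomial[of J "\<lambda>_. 0" 0] by simp

lemma box_polynomial_power:
  assumes "box_polynomial J K h"
  shows "box_polynomial J (n * K) (\<lambda>x. h x ^ n)"
proof (induction n)
  case 0
  then show ?case by (simp add: box_polynomial_one)
next
  case (Suc n)
  then show ?case using box_polynomial_mult[OF assms Suc] by simp
qed

lemma box_polynomial_prod:
  assumes "finite S" and "\<And>s. s \<in> S \<Longrightarrow> box_polynomial J (K s) (h s)"
  shows "box_polynomial J (\<Sum>s\<in>S. K s) (\<lambda>x. \<Prod>s\<in>S. h s x)"
  using assms
proof (induction S rule: finite_induct)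
  case empty
  then show ?case by (simp add: box_polynomial_one)
next
  case (insert s S)
  then show ?case using box_polynomial_mult[of J "K s" "h s" "sum K S"] by simp
qed

lemma box_polynomial_coordinate:
  assumes "j \<in> J"
  shows "box_polynomial J 1 (\<lambda>x. x $ j)"
proof -
  have "box_polynomial J 1 (\<lambda>x. \<Prod>i\<in>J. x $ i ^ (if i = j then 1 else 0))"
    by (rule box_polynomial_monomial) auto
  moreover have "(\<Prod>i\<in>J. x $ i ^ (if i = j then 1 else 0)) = x $ j" for x :: "complex ^ 'a"
  proof -
    have "(\<Prod>i\<in>J. x $ i ^ (if i = j then 1 else 0)) = (\<Prod>i\<in>J. if i = j then x $ i else 1)"
      by (rule prod.cong) auto
    then show ?thesis using assms by (simp add: prod.delta)
  qed
  ultimately show ?thesis by simp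
qed

lemma box_polynomial_poly_eval:
  fixes p :: "'n::finite rpoly"
  shows "\<exists>K. box_polynomial J K (poly_eval p)"
proof -
  define K where "K = (\<Sum>m\<in>Poly_Mapping.keys p. \<Sum>i\<in>UNIV. Poly_Mapping.lookup m i)"
  have le: "Poly_Mapping.lookup m i \<le> K" if "m \<in> Poly_Mapping.keys p" for m i
  proof -
    have "Poly_Mapping.lookup m i \<le> (\<Sum>i\<in>UNIV. Poly_Mapping.lookup m i)"
      by (rule member_le_sum) auto
    also have "\<dots> \<le> K" unfolding K_def
      by (rule member_le_sum[OF that]) auto
    finally show ?thesis .
  qed
  \<comment> \<open>A monomial that involves a variable outside \<open>J\<close> vanishes on the subspace.\<close>
  let ?r = "\<lambda>m. if \<forall>i. i \<notin> J \<longrightarrow> Poly_Mapping.lookup m i = 0 then 1 else (0::complex)"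
  have "box_polynomial J K (\<lambda>x. \<Sum>m\<in>Poly_Mapping.keys p.
      (of_real (Poly_Mapping.lookup p m) * ?r m) * (\<Prod>i\<in>J. x $ i ^ Poly_Mapping.lookup m i))"
    by (intro box_polynomial_sum box_polynomial_cmult box_polynomial_monomial le)
  then have "box_polynomial J K (poly_eval p)"
  proof (rule box_polynomial_cong)
    fix x :: "complex ^ 'n" assume x: "\<forall>i. i \<notin> J \<longrightarrow> x $ i = 0"
    have "(\<Prod>i\<in>UNIV. x $ i ^ Poly_Mapping.lookup m i) =
        ?r m * (\<Prod>i\<in>J. x $ i ^ Poly_Mapping.lookup m i)" for m
    proof (cases "\<forall>i. i \<notin> J \<longrightarrow> Poly_Mapping.lookup m i = 0")
      case True
      then show ?thesis by (simp, intro prod.mono_neutral_right) auto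
    next
      case False
      then obtain i where "i \<notin> J" "Poly_Mapping.lookup m i \<noteq> 0" by blast
      then have "(\<Prod>i\<in>UNIV. x $ i ^ Poly_Mapping.lookup m i) = 0"
        using x by (intro prod_zero) (auto intro!: bexI[of _ i])
      with False show ?thesis by (simp only: if_False mult_zero_left)
    qed
    then show "poly_eval p x = (\<Sum>m\<in>Poly_Mapping.keys p.
      (of_real (Poly_Mapping.lookup p m) * ?r m) * (\<Prod>i\<in>J. x $ i ^ Poly_Mapping.lookup m i))"
      unfolding poly_eval_def by (simp add: mult.assoc)
  qed
  then show ?thesis ..
qed

text \<open>
  One polynomial function more than there are variables forces a nontrivial polynomial relation. The
  \<open>(N + 1)\<^bsup>|J| + 1\<^esup>\<close> products of powers with exponents at most \<open>N\<close> all lie in a space spanned by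
  \<open>(L + 1)\<^bsup>|J|\<^esup>\<close> monomials, where \<open>L\<close> grows only linearly in \<open>N\<close>; so for large \<open>N\<close> they are
  linearly dependent. The relation is sorted by powers of \<open>g\<close>, since it is going to be read as an
  equation for the value of \<open>g\<close> once the values of the \<open>h i\<close> are prescribed.
\<close>

lemma box_polynomials_algebraically_dependent:
  fixes h :: "'n::finite \<Rightarrow> complex ^ 'n \<Rightarrow> complex"
  assumes g: "box_polynomial J D g" and h: "\<And>i. i \<in> J \<Longrightarrow> box_polynomial J D (h i)"
  shows "\<exists>N c. (\<exists>k\<le>N. \<exists>\<beta>\<in>PiE J (\<lambda>_. {..N}). c k \<beta> \<noteq> 0) \<and>
     (\<forall>x. (\<forall>i. i \<notin> J \<longrightarrow> x $ i = 0) \<longrightarrow>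
        (\<Sum>k\<le>N. (\<Sum>\<beta>\<in>PiE J (\<lambda>_. {..N}). c k \<beta> * (\<Prod>i\<in>J. h i x ^ \<beta> i)) * g x ^ k) = 0)"
proof -
  \<comment> \<open>This choice of \<open>N\<close> turns the bound on \<open>card B\<close> into \<open>N * (N + 1) ^ card J\<close>.\<close>
  define N where "N = ((card J + 1) * D + 1) ^ card J"
  define L where "L = (card J + 1) * (N * D)"
  define A where "A = {..N} \<times> PiE J (\<lambda>_. {..N})"
  define B where "B = PiE J (\<lambda>_. {..L})"
  have fin: "finite A" "finite B" by (auto simp: A_def B_def finite_PiE)
  define e where "e = (card J + 1) * D"
  have "L = e * N" by (simp add: L_def e_def algebra_simps)
  then have "L + 1 \<le> (e + 1) * (N + 1)" by simp
  then have "(L + 1) ^ card J \<le> ((e + 1) * (N + 1)) ^ card J" by (rule power_mono) simp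
  then have "card B \<le> ((e + 1) * (N + 1)) ^ card J" by (simp add: B_def card_PiE)
  also have "\<dots> = N * (N + 1) ^ card J"
    unfolding N_def e_def by (rule power_mult_distrib)
  also have "\<dots> < (N + 1) * (N + 1) ^ card J"
    by (intro mult_strict_right_mono) auto
  also have "\<dots> = card A"
    by (simp add: A_def card_cartesian_product card_PiE)
  finally have card: "card B < card A" .
  have box: "box_polynomial J L (\<lambda>x. (\<Prod>i\<in>J. h i x ^ snd a i) * g x ^ fst a)" if "a \<in> A" for a
  proof -
    have "box_polynomial J ((\<Sum>i\<in>J. snd a i * D) + fst a * D)
        (\<lambda>x. (\<Prod>i\<in>J. h i x ^ snd a i) * g x ^ fst a)"
      by (intro box_polynomial_mult box_polynomial_prod box_polynomial_power g h) auto
    moreover have "(\<Sum>i\<in>J. snd a i * D) + fst a * D \<le> L"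
    proof -
      have "(\<Sum>i\<in>J. snd a i * D) \<le> (\<Sum>i\<in>J. N * D)"
        using that by (intro sum_mono mult_right_mono) (auto simp: A_def PiE_iff)
      moreover have "fst a * D \<le> N * D"
        using that by (intro mult_right_mono) (auto simp: A_def)
      ultimately have "(\<Sum>i\<in>J. snd a i * D) + fst a * D \<le> card J * (N * D) + N * D"
        by (simp only: sum_constant add_mono of_nat_id)
      then show ?thesis by (simp add: L_def)
    qed
    ultimately show ?thesis by (rule box_polynomial_mono)
  qed
  then have "\<forall>a\<in>A. \<exists>m. \<forall>x. (\<forall>i. i \<notin> J \<longrightarrow> x $ i = 0) \<longrightarrow>
      (\<Prod>i\<in>J. h i x ^ snd a i) * g x ^ fst a = (\<Sum>\<beta>\<in>B. m \<beta> * (\<Prod>i\<in>J. x $ i ^ \<beta> i))"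
    unfolding box_polynomial_def B_def by blast
  from bchoice[OF this] obtain M where "\<forall>a\<in>A. \<forall>x. (\<forall>i. i \<notin> J \<longrightarrow> x $ i = 0) \<longrightarrow>
      (\<Prod>i\<in>J. h i x ^ snd a i) * g x ^ fst a = (\<Sum>\<beta>\<in>B. M a \<beta> * (\<Prod>i\<in>J. x $ i ^ \<beta> i))" ..
  then have M: "(\<Prod>i\<in>J. h i x ^ snd a i) * g x ^ fst a = (\<Sum>\<beta>\<in>B. M a \<beta> * (\<Prod>i\<in>J. x $ i ^ \<beta> i))"
    if "a \<in> A" "\<forall>i. i \<notin> J \<longrightarrow> x $ i = 0" for a x
    using that by simp
  obtain c where c: "\<exists>a\<in>A. c a \<noteq> 0" "\<forall>\<beta>\<in>B. (\<Sum>a\<in>A. c a * M a \<beta>) = 0"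
    using nontrivial_linear_relation[OF fin(2,1) card, of M] by blast
  have "(\<Sum>k\<le>N. (\<Sum>\<beta>\<in>PiE J (\<lambda>_. {..N}). c (k, \<beta>) * (\<Prod>i\<in>J. h i x ^ \<beta> i)) * g x ^ k) = 0"
    if x: "\<forall>i. i \<notin> J \<longrightarrow> x $ i = 0" for x
  proof -
    have "(\<Sum>k\<le>N. (\<Sum>\<beta>\<in>PiE J (\<lambda>_. {..N}). c (k, \<beta>) * (\<Prod>i\<in>J. h i x ^ \<beta> i)) * g x ^ k) =
        (\<Sum>a\<in>A. c a * ((\<Prod>i\<in>J. h i x ^ snd a i) * g x ^ fst a))"
      by (simp add: A_def sum_distrib_right sum.cartesian_product case_prod_beta mult.assoc)
    also have "\<dots> = (\<Sum>a\<in>A. \<Sum>\<beta>\<in>B. c a * M a \<beta> * (\<Prod>i\<in>J. x $ i ^ \<beta> i))"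
      by (intro sum.cong refl) (simp add: M[OF _ x] sum_distrib_left mult.assoc)
    also have "\<dots> = (\<Sum>\<beta>\<in>B. \<Sum>a\<in>A. c a * M a \<beta> * (\<Prod>i\<in>J. x $ i ^ \<beta> i))"
      by (rule sum.swap)
    also have "\<dots> = (\<Sum>\<beta>\<in>B. (\<Sum>a\<in>A. c a * M a \<beta>) * (\<Prod>i\<in>J. x $ i ^ \<beta> i))"
      by (simp add: sum_distrib_right)
    also have "\<dots> = 0" using c(2) by simp
    finally show ?thesis .
  qed
  moreover have "\<exists>k\<le>N. \<exists>\<beta>\<in>PiE J (\<lambda>_. {..N}). c (k, \<beta>) \<noteq> 0"
    using c(1) by (auto simp: A_def)
  ultimately show ?thesis
    by (intro exI[of _ N] exI[of _ "\<lambda>k \<beta>. c (k, \<beta>)"]) blast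
qed

section \<open>Zero sets of polynomials are null sets\<close>

text \<open>
  Average the measure of \<open>S\<close>, which is translation invariant, over the translates by \<open>-\<gamma> t\<close> with
  \<open>t \<in> [0, 1]\<close>. After exchanging the integrals, the inner one measures a finite set of times \<open>t\<close>.
\<close>

lemma null_if_curve_meets_translates_finitely:
  fixes S :: "'a::euclidean_space set" and \<gamma> :: "real \<Rightarrow> 'a"
  assumes S: "S \<in> sets borel" and \<gamma>: "continuous_on UNIV \<gamma>"
    and fin: "\<And>x. finite {t. x + \<gamma> t \<in> S}"
  shows "S \<in> null_sets lborel"
proof -
  have [measurable]: "S \<in> sets borel" "\<gamma> \<in> borel_measurable borel"
    using S \<gamma> by (auto intro: borel_measurable_continuous_onI)
  have translate: "(\<integral>\<^sup>+x. indicator S (x + \<gamma> t) \<partial>lborel) = emeasure lborel S" for t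
  proof -
    have "(\<integral>\<^sup>+x. indicator S x \<partial>lborel) = (\<integral>\<^sup>+x. indicator S x \<partial>distr lborel borel ((+) (\<gamma> t)))"
      by (simp add: lborel_distr_plus)
    also have "\<dots> = (\<integral>\<^sup>+x. indicator S (\<gamma> t + x) \<partial>lborel)"
      by (rule nn_integral_distr) auto
    finally show ?thesis by (simp add: add.commute)
  qed
  have "emeasure lborel S = (\<integral>\<^sup>+t. emeasure lborel S * indicator {0..1::real} t \<partial>lborel)"
    by (simp add: nn_integral_cmult_indicator)
  also have "\<dots> = (\<integral>\<^sup>+t. (\<integral>\<^sup>+x. indicator S (x + \<gamma> t) * indicator {0..1::real} t \<partial>lborel) \<partial>lborel)"
    by (simp add: nn_integral_multc translate)
  also have "\<dots> = (\<integral>\<^sup>+x. (\<integral>\<^sup>+t. indicator S (x + \<gamma> t) * indicator {0..1::real} t \<partial>lborel) \<partial>lborel)"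
    by (rule lborel_pair.Fubini') measurable
  also have "\<dots> = (\<integral>\<^sup>+(x::'a). 0 \<partial>lborel)"
  proof (rule nn_integral_cong)
    fix x :: 'a
    have "{t. x + \<gamma> t \<in> S} \<in> null_sets lborel"
      using fin[of x] by (intro finite_imp_null_set_lborel)
    then have "AE t in lborel. t \<notin> {t. x + \<gamma> t \<in> S}"
      by (rule AE_not_in)
    then have "AE t in lborel. indicator S (x + \<gamma> t) * indicator {0..1::real} t = (0::ennreal)"
      by eventually_elim auto
    then show "(\<integral>\<^sup>+t. indicator S (x + \<gamma> t) * indicator {0..1::real} t \<partial>lborel) = 0"
      by (subst nn_integral_0_iff_AE) auto
  qed
  finally show ?thesis by (auto intro!: null_setsI)
qed

text \<open>
  The weights are powers of \<open>K + 1\<close>, so that the weighted sum lists the exponents as digits in base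
  \<open>K + 1\<close>.
\<close>

lemma separating_weights:
  assumes "finite J"
  shows "\<exists>w. (\<forall>i\<in>J. 0 < w i) \<and> inj_on (\<lambda>\<beta>. \<Sum>i\<in>J. w i * \<beta> i) (PiE J (\<lambda>_. {..K::nat}))"
  using assms
proof (induction J rule: finite_induct)
  case empty
  then show ?case by simp
next
  case (insert j J)
  then obtain w where w: "\<forall>i\<in>J. 0 < w i"
    "inj_on (\<lambda>\<beta>. \<Sum>i\<in>J. w i * \<beta> i) (PiE J (\<lambda>_. {..K}))" by blast
  define w' where "w' i = (if i = j then 1 else (K + 1) * w i)" for i
  have sum: "(\<Sum>i\<in>insert j J. w' i * \<beta> i) = \<beta> j + (K + 1) * (\<Sum>i\<in>J. w i * \<beta> i)" for \<beta>
  proof -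
    have "(\<Sum>i\<in>J. w' i * \<beta> i) = (\<Sum>i\<in>J. (K + 1) * (w i * \<beta> i))"
      using insert.hyps by (intro sum.cong) (auto simp: w'_def algebra_simps)
    also have "\<dots> = (K + 1) * (\<Sum>i\<in>J. w i * \<beta> i)"
      by (rule sum_distrib_left[symmetric])
    finally show ?thesis
      using insert.hyps by (simp add: w'_def)
  qed
  have "\<beta> = \<gamma>"
    if \<beta>: "\<beta> \<in> PiE (insert j J) (\<lambda>_. {..K})" and \<gamma>: "\<gamma> \<in> PiE (insert j J) (\<lambda>_. {..K})"
      and eq: "(\<Sum>i\<in>insert j J. w' i * \<beta> i) = (\<Sum>i\<in>insert j J. w' i * \<gamma> i)" for \<beta> \<gamma>
  proof -
    let ?s = "\<lambda>\<beta>. \<Sum>i\<in>J. w i * \<beta> i"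
    have lt: "\<beta> j < K + 1" "\<gamma> j < K + 1" using \<beta> \<gamma> by (auto simp: PiE_iff)
    have eq': "\<beta> j + (K + 1) * ?s \<beta> = \<gamma> j + (K + 1) * ?s \<gamma>"
      using eq unfolding sum .
    have j: "\<beta> j = \<gamma> j"
      using arg_cong[OF eq', of "\<lambda>n. n mod (K + 1)"] lt by (simp del: mult_Suc add: mod_mult_self2)
    then have "(K + 1) * ?s \<beta> = (K + 1) * ?s \<gamma>" using eq' by linarith
    then have s: "?s \<beta> = ?s \<gamma>" by (simp only: mult_cancel1) simp
    have "?s (restrict \<beta> J) = ?s (restrict \<gamma> J)" using s by simp
    moreover have "restrict \<beta> J \<in> PiE J (\<lambda>_. {..K})" "restrict \<gamma> J \<in> PiE J (\<lambda>_. {..K})"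
      using \<beta> \<gamma> by (auto simp: PiE_iff)
    ultimately have "restrict \<beta> J = restrict \<gamma> J"
      by (rule inj_onD[OF w(2)])
    then have "\<beta> i = \<gamma> i" if "i \<in> insert j J" for i
      using that j by (cases "i = j") (auto dest: fun_cong[of _ _ i])
    then show ?thesis using \<beta> \<gamma> by (intro PiE_ext) auto
  qed
  then have "inj_on (\<lambda>\<beta>. \<Sum>i\<in>insert j J. w' i * \<beta> i) (PiE (insert j J) (\<lambda>_. {..K}))"
    by (auto intro!: inj_onI)
  moreover have "\<forall>i\<in>insert j J. 0 < w' i" using w(1) by (auto simp: w'_def)
  ultimately show ?case by blast
qed

text \<open>
  Kronecker substitution: along the curve \<open>t \<mapsto> (t\<^bsup>w i\<^esup>)\<^sub>i\<close> with separating weights, different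
  monomials acquire different degrees in \<open>t\<close>. Hence the restriction of the polynomial to any
  translate of the curve is a nonzero polynomial in \<open>t\<close>, with finitely many roots. This treats all
  variables at once, without an induction that integrates them out one at a time.
\<close>

lemma null_zero_set_of_nonzero_polynomial:
  fixes c :: "('n::finite \<Rightarrow> nat) \<Rightarrow> complex"
  assumes "\<exists>\<beta>\<in>PiE J (\<lambda>_. {..K}). c \<beta> \<noteq> 0"
  shows "{a :: real ^ 'n. (\<Sum>\<beta>\<in>PiE J (\<lambda>_. {..K}). c \<beta> * (\<Prod>i\<in>J. of_real (a $ i) ^ \<beta> i)) = 0}
     \<in> null_sets lborel"
proof -
  let ?B = "PiE J (\<lambda>_. {..K})"
  let ?Z = "{a :: real ^ 'n. (\<Sum>\<beta>\<in>?B. c \<beta> * (\<Prod>i\<in>J. of_real (a $ i) ^ \<beta> i)) = 0}"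
  obtain w where w: "\<forall>i\<in>J. 0 < w i" "inj_on (\<lambda>\<beta>. \<Sum>i\<in>J. w i * \<beta> i) ?B"
    using separating_weights[of J K] by auto
  define \<gamma> :: "real \<Rightarrow> real ^ 'n" where "\<gamma> t = (\<chi> i. t ^ w i)" for t
  have "closed ?Z"
    by (intro closed_Collect_eq continuous_intros)
  then have "?Z \<in> sets borel" by simp
  moreover have "continuous_on UNIV \<gamma>"
    unfolding \<gamma>_def by (intro continuous_intros)
  moreover have "finite {t. x + \<gamma> t \<in> ?Z}" for x
  proof -
    define F where "F i = [:complex_of_real (x $ i):] + Polynomial.monom 1 (w i)" for i
    define T where "T \<beta> = (\<Prod>i\<in>J. F i ^ \<beta> i)" for \<beta> :: "'n \<Rightarrow> nat"
    define Q where "Q = (\<Sum>\<beta>\<in>?B. Polynomial.smult (c \<beta>) (T \<beta>))"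
    have F: "degree (F i) = w i" "lead_coeff (F i) = 1" if "i \<in> J" for i
    proof -
      have "degree [:complex_of_real (x $ i):] < degree (Polynomial.monom (1::complex) (w i))"
        using w(1) that by (simp add: degree_monom_eq)
      then show "degree (F i) = w i" "lead_coeff (F i) = 1" unfolding F_def
        using w(1) that by (auto simp: degree_add_eq_right degree_monom_eq coeff_pCons split: nat.split)
    qed
    have F0: "F i \<noteq> 0" if "i \<in> J" for i using F[OF that] by auto
    have T: "degree (T \<beta>) = (\<Sum>i\<in>J. w i * \<beta> i)" "lead_coeff (T \<beta>) = 1" for \<beta>
    proof -
      have "degree (T \<beta>) = (\<Sum>i\<in>J. degree (F i ^ \<beta> i))"
        unfolding T_def using F0 by (intro degree_prod_eq_sum_degree) auto
      also have "\<dots> = (\<Sum>i\<in>J. w i * \<beta> i)"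
        using F F0 by (intro sum.cong) (auto simp: degree_power_eq)
      finally show "degree (T \<beta>) = (\<Sum>i\<in>J. w i * \<beta> i)" .
      show "lead_coeff (T \<beta>) = 1"
        unfolding T_def using F by (simp add: lead_coeff_prod lead_coeff_power)
    qed
    \<comment> \<open>Among the monomials present, the one of largest weighted degree cannot be cancelled.\<close>
    define C where "C = {\<beta>\<in>?B. c \<beta> \<noteq> 0}"
    have C: "finite C" "C \<noteq> {}" using assms by (auto simp: C_def finite_PiE)
    define d where "d = Max ((\<lambda>\<beta>. degree (T \<beta>)) ` C)"
    have "d \<in> (\<lambda>\<beta>. degree (T \<beta>)) ` C" unfolding d_def using C by (intro Max_in) auto
    then obtain \<beta>0 where \<beta>0: "\<beta>0 \<in> C" "d = degree (T \<beta>0)" by blast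
    have "c \<beta> * coeff (T \<beta>) d = (if \<beta> = \<beta>0 then c \<beta>0 else 0)" if "\<beta> \<in> ?B" for \<beta>
    proof (cases "\<beta> = \<beta>0 \<or> c \<beta> = 0")
      case True
      then show ?thesis using \<beta>0 T(2)[of \<beta>0] by auto
    next
      case False
      then have "\<beta> \<in> C" using that by (auto simp: C_def)
      then have "degree (T \<beta>) \<le> d" unfolding d_def using C by simp
      moreover have "degree (T \<beta>) \<noteq> d"
        using w(2) that \<beta>0 False by (auto simp: C_def T(1) inj_on_def)
      ultimately show ?thesis using False by (simp add: coeff_eq_0)
    qed
    then have "coeff Q d = (\<Sum>\<beta>\<in>?B. if \<beta> = \<beta>0 then c \<beta>0 else 0)"
      by (simp add: Q_def coeff_sum)
    also have "\<dots> = c \<beta>0" using \<beta>0 by (simp add: C_def finite_PiE)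
    finally have "Q \<noteq> 0" using \<beta>0 by (auto simp: C_def)
    then have "finite {z. poly Q z = 0}" by (rule poly_roots_finite)
    then have "finite (of_real -` {z. poly Q z = 0} :: real set)"
      by (rule finite_vimageI) (auto simp: inj_def)
    moreover have "{t. x + \<gamma> t \<in> ?Z} \<subseteq> of_real -` {z. poly Q z = 0}"
      by (auto simp: Q_def T_def F_def poly_sum poly_prod poly_monom \<gamma>_def)
    ultimately show ?thesis by (rule finite_subset[rotated])
  qed
  ultimately show ?thesis by (rule null_if_curve_meets_translates_finitely)
qed

section \<open>Finiteness for generic translations\<close>

text \<open>
  On \<open>\<complex>\<^sup>J\<close> the coordinate \<open>x\<^sub>j\<close> and the components \<open>-f\<^sub>i\<close> with \<open>i \<in> J\<close> satisfy a
  polynomial relation. On the fibre over \<open>a\<close> it becomes an equation in \<open>x\<^sub>j\<close> alone, whose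
  coefficients are polynomials in \<open>a\<close>. One of these is a nonzero polynomial, and as long as it does
  not vanish at \<open>a\<close>, only finitely many values of \<open>x\<^sub>j\<close> are possible.
\<close>

lemma coordinate_finite_for_almost_all_values:
  fixes f :: "('n::finite) polymap"
  assumes j: "j \<in> J"
  shows "\<exists>Z \<in> null_sets lborel. \<forall>a. a \<notin> Z \<longrightarrow>
     finite {x $ j | x :: complex ^ 'n.
        (\<forall>i. i \<notin> J \<longrightarrow> x $ i = 0) \<and> (\<forall>i\<in>J. map_eval f x $ i + of_real (a $ i) = 0)}"
proof -
  have "\<forall>i. \<exists>K. box_polynomial J K (poly_eval (f $ i))"
    by (simp add: box_polynomial_poly_eval)
  then obtain K where K: "\<And>i. box_polynomial J (K i) (poly_eval (f $ i))"
    by metis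
  define D where "D = 1 + (\<Sum>i\<in>UNIV. K i)"
  have KD: "K i \<le> D" for i
    using member_le_sum[of i UNIV K] by (simp add: D_def)
  define h where "h i x = - 1 * poly_eval (f $ i) x" for i and x :: "complex ^ 'n"
  have "box_polynomial J D (h i)" for i
    unfolding h_def by (intro box_polynomial_cmult box_polynomial_mono[OF K KD])
  moreover have "box_polynomial J D (\<lambda>x. x $ j)"
    by (rule box_polynomial_mono[OF box_polynomial_coordinate[OF j]]) (simp add: D_def)
  ultimately obtain N c where nz: "\<exists>k\<le>N. \<exists>\<beta>\<in>PiE J (\<lambda>_. {..N}). c k \<beta> \<noteq> 0"
    and rel: "\<And>x. (\<forall>i. i \<notin> J \<longrightarrow> x $ i = 0) \<Longrightarrow>
        (\<Sum>k\<le>N. (\<Sum>\<beta>\<in>PiE J (\<lambda>_. {..N}). c k \<beta> * (\<Prod>i\<in>J. h i x ^ \<beta> i)) * x $ j ^ k) = 0"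
    using box_polynomials_algebraically_dependent[of J D "\<lambda>x. x $ j" h] by blast
  obtain k0 where k0: "k0 \<le> N" "\<exists>\<beta>\<in>PiE J (\<lambda>_. {..N}). c k0 \<beta> \<noteq> 0" using nz by blast
  define q where "q k a = (\<Sum>\<beta>\<in>PiE J (\<lambda>_. {..N}). c k \<beta> * (\<Prod>i\<in>J. complex_of_real (a $ i) ^ \<beta> i))"
    for k and a :: "real ^ 'n"
  have "{a. q k0 a = 0} \<in> null_sets lborel"
    unfolding q_def using k0(2) by (rule null_zero_set_of_nonzero_polynomial)
  moreover have "finite {x $ j | x :: complex ^ 'n.
        (\<forall>i. i \<notin> J \<longrightarrow> x $ i = 0) \<and> (\<forall>i\<in>J. map_eval f x $ i + of_real (a $ i) = 0)}"
    (is "finite ?X") if "a \<notin> {a. q k0 a = 0}" for a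
  proof -
    define P where "P = (\<Sum>k\<le>N. Polynomial.monom (q k a) k)"
    have "coeff P k0 = q k0 a" using k0(1) by (simp add: P_def coeff_sum)
    then have "P \<noteq> 0" using that by auto
    then have "finite {z. poly P z = 0}" by (rule poly_roots_finite)
    moreover have "?X \<subseteq> {z. poly P z = 0}"
    proof clarify
      fix x :: "complex ^ 'n"
      assume x: "\<forall>i. i \<notin> J \<longrightarrow> x $ i = 0"
        and eq: "\<forall>i\<in>J. map_eval f x $ i + of_real (a $ i) = 0"
      have "h i x = of_real (a $ i)" if "i \<in> J" for i
        using eq that by (simp add: h_def map_eval_def neg_eq_iff_add_eq_0)
      then have "poly P (x $ j) =
          (\<Sum>k\<le>N. (\<Sum>\<beta>\<in>PiE J (\<lambda>_. {..N}). c k \<beta> * (\<Prod>i\<in>J. h i x ^ \<beta> i)) * x $ j ^ k)"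
        by (simp add: P_def q_def poly_sum poly_monom)
      then show "poly P (x $ j) = 0" using rel[OF x] by simp
    qed
    ultimately show ?thesis by (rule finite_subset[rotated])
  qed
  ultimately show ?thesis by blast
qed

lemma finite_vectors_with_finite_coordinates:
  assumes "\<And>j. finite (R j)"
  shows "finite {x :: 'a ^ 'n::finite. \<forall>j. x $ j \<in> R j}"
proof -
  have "finite (PiE UNIV R)" using assms by (simp add: finite_PiE)
  then have "finite (vec_lambda ` PiE UNIV R)" by simp
  moreover have "{x :: 'a ^ 'n. \<forall>j. x $ j \<in> R j} \<subseteq> vec_lambda ` PiE UNIV R"
  proof clarify
    fix x :: "'a ^ 'n" assume "\<forall>j. x $ j \<in> R j"
    then show "x \<in> vec_lambda ` PiE UNIV R"
      by (intro image_eqI[of _ _ "vec_nth x"]) auto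
  qed
  ultimately show ?thesis by (rule finite_subset[rotated])
qed

text \<open>
  A solution of the system \<open>x\<^sub>i (f\<^sub>i(x) + a\<^sub>i) = 0\<close> with support \<open>J\<close> satisfies
  \<open>f\<^sub>i(x) = -a\<^sub>i\<close> for all \<open>i \<in> J\<close>. There are finitely many supports, and on each of them every
  coordinate takes finitely many values for almost all \<open>a\<close>.
\<close>

theorem generic_translation_D0:
  fixes f :: "('n::finite) polymap"
  shows "\<exists>A. generic A \<and> (\<forall>a\<in>A. D0 (f + const_map a))"
proof -
  define X where "X J j a = {x $ j | x :: complex ^ 'n.
        (\<forall>i. i \<notin> J \<longrightarrow> x $ i = 0) \<and> (\<forall>i\<in>J. map_eval f x $ i + of_real (a $ i) = 0)}" for J j a
  define P where "P = {(J, j :: 'n). j \<in> J}"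
  have "\<forall>p\<in>P. \<exists>Z. Z \<in> null_sets lborel \<and> (\<forall>a. a \<notin> Z \<longrightarrow> finite (X (fst p) (snd p) a))"
  proof
    fix p assume "p \<in> P"
    then have "snd p \<in> fst p" by (auto simp: P_def)
    from coordinate_finite_for_almost_all_values[OF this, of f]
    show "\<exists>Z. Z \<in> null_sets lborel \<and> (\<forall>a. a \<notin> Z \<longrightarrow> finite (X (fst p) (snd p) a))"
      unfolding X_def Bex_def .
  qed
  from bchoice[OF this] obtain Z where
    Z: "\<forall>p\<in>P. Z p \<in> null_sets lborel \<and> (\<forall>a. a \<notin> Z p \<longrightarrow> finite (X (fst p) (snd p) a))" ..
  define U where "U = (\<Union>p\<in>P. Z p)"
  have "U \<in> null_sets lborel"
    unfolding U_def using Z by (intro null_sets_UN') (simp_all add: countable_finite)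
  then have "generic (- U)"
    by (simp add: generic_def null_sets_completionI)
  moreover have "D0 (f + const_map a)" if "a \<in> - U" for a
  proof -
    define R where "R j = insert 0 (\<Union>J\<in>{J. j \<in> J}. X J j a)" for j
    have "finite (R j)" for j
    proof -
      have "finite (X J j a)" if "j \<in> J" for J
      proof -
        have "(J, j) \<in> P" using that by (simp add: P_def)
        moreover from this have "a \<notin> Z (J, j)" using \<open>a \<in> - U\<close> by (auto simp: U_def)
        ultimately show ?thesis using Z by fastforce
      qed
      then show ?thesis unfolding R_def by simp
    qed
    then have "finite {x :: complex ^ 'n. \<forall>j. x $ j \<in> R j}"
      by (intro finite_vectors_with_finite_coordinates) auto
    moreover have "x $ j \<in> R j"
      if x: "\<forall>i. x $ i * (map_eval (f + const_map a) x) $ i = 0" for x :: "complex ^ 'n" and j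
    proof (cases "x $ j = 0")
      case True
      then show ?thesis by (simp add: R_def)
    next
      case False
      let ?J = "{i. x $ i \<noteq> 0}"
      have "x $ j \<in> X ?J j a"
        unfolding X_def using x by (auto simp: map_eval_add_const)
      then show ?thesis using False by (auto simp: R_def)
    qed
    ultimately show ?thesis
      unfolding D0_def by (elim finite_subset[rotated]) blast
  qed
  ultimately show ?thesis by blast
qed

section \<open>Behaviour at infinity\<close>

lemma monom_degree_le_map_degree:
  assumes "m \<in> Poly_Mapping.keys (f $ i)"
  shows "monom_degree m \<le> map_degree f"
proof -
  have "monom_degree m \<le> poly_degree (f $ i)"
    unfolding poly_degree_def using assms by (intro Max_ge) auto
  also have "\<dots> \<le> map_degree f"
    unfolding map_degree_def by (intro Max_ge) auto
  finally show ?thesis .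
qed

lemma poly_eval_hom_component:
  "poly_eval (hom_component d p) x =
     (\<Sum>m\<in>Poly_Mapping.keys p.
        if monom_degree m = d
        then of_real (Poly_Mapping.lookup p m) * (\<Prod>i\<in>UNIV. (x $ i) ^ Poly_Mapping.lookup m i) else 0)"
proof -
  have lookup: "Poly_Mapping.lookup (hom_component d p) m =
      (if monom_degree m = d then Poly_Mapping.lookup p m else 0)" for m
  proof -
    have "Poly_Mapping.lookup (hom_component d p) m =
        (\<Sum>m'\<in>{m \<in> Poly_Mapping.keys p. monom_degree m = d}.
           if m' = m then Poly_Mapping.lookup p m' else 0)"
      by (simp add: hom_component_def lookup_sum lookup_single when_def)
    then show ?thesis by (auto simp: in_keys_iff)
  qed
  then have "Poly_Mapping.keys (hom_component d p) \<subseteq> Poly_Mapping.keys p"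
    by (auto simp: in_keys_iff split: if_splits)
  then show ?thesis
    by (subst poly_eval_superset[where S = "Poly_Mapping.keys p"])
       (auto simp: lookup intro!: sum.cong)
qed

lemma continuous_on_map_eval:
  fixes g :: "('n::finite) polymap"
  shows "continuous_on S (map_eval g :: real ^ 'n \<Rightarrow> real ^ 'n)"
  unfolding map_eval_def poly_eval_def by (intro continuous_intros)

text \<open>
  Each monomial of degree \<open>d - e\<close> is left with a factor \<open>r\<^bsup>-e\<^esup>\<close>. Constant maps are
  included: then \<open>d = 0\<close>, nothing is divided away, and the perturbations disappear because they tend
  to zero themselves.
\<close>

lemma map_eval_rescaled_tendsto_leading_map:
  fixes f :: "('n::finite) polymap" and u :: "nat \<Rightarrow> real ^ 'n"
  assumes r: "filterlim r at_top sequentially" and u: "u \<longlonglongrightarrow> v" and a: "a \<longlonglongrightarrow> 0"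
  shows "(\<lambda>k. (map_eval f (r k *\<^sub>R u k) + a k) /\<^sub>R r k ^ map_degree f) \<longlonglongrightarrow>
     map_eval (leading_map f) v"
proof (rule vec_tendstoI)
  fix i
  let ?d = "map_degree f"
  let ?p = "f $ i"
  let ?mono = "\<lambda>m x. \<Prod>i\<in>UNIV. (x $ i) ^ Poly_Mapping.lookup m i"
  have pos: "\<forall>\<^sub>F k in sequentially. 0 < r k"
    using r by (auto simp: filterlim_at_top_dense)
  have rinv: "(\<lambda>k. inverse (r k)) \<longlonglongrightarrow> 0"
    using r by (rule tendsto_inverse_0_at_top)
  have mono: "?mono m (c *\<^sub>R x) = c ^ monom_degree m * ?mono m x" for m c and x :: "real ^ 'n"
    by (simp add: power_mult_distrib prod.distrib monom_degree_def power_sum)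
  have summand: "(\<lambda>k. Poly_Mapping.lookup ?p m * ?mono m (r k *\<^sub>R u k) / r k ^ ?d) \<longlonglongrightarrow>
      (if monom_degree m = ?d then Poly_Mapping.lookup ?p m * ?mono m v else 0)"
    if m: "m \<in> Poly_Mapping.keys ?p" for m
  proof -
    define e where "e = ?d - monom_degree m"
    have e: "?d = monom_degree m + e"
      using monom_degree_le_map_degree[OF m] by (simp add: e_def)
    have lim: "(\<lambda>k. Poly_Mapping.lookup ?p m * ?mono m (u k) * inverse (r k) ^ e) \<longlonglongrightarrow>
        Poly_Mapping.lookup ?p m * ?mono m v * 0 ^ e"
      by (intro tendsto_intros u rinv)
    have coeff: "Poly_Mapping.lookup ?p m * ?mono m v * 0 ^ e =
        (if monom_degree m = ?d then Poly_Mapping.lookup ?p m * ?mono m v else 0)"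
      using e by (cases e) auto
    have "\<forall>\<^sub>F k in sequentially. Poly_Mapping.lookup ?p m * ?mono m (u k) * inverse (r k) ^ e
        = Poly_Mapping.lookup ?p m * ?mono m (r k *\<^sub>R u k) / r k ^ ?d"
      using pos by eventually_elim (simp only: mono, simp add: e power_add field_simps)
    with lim show ?thesis unfolding coeff by (rule Lim_transform_eventually)
  qed
  have "(\<lambda>k. poly_eval ?p (r k *\<^sub>R u k) / r k ^ ?d) \<longlonglongrightarrow> poly_eval (hom_component ?d ?p) v"
    unfolding poly_eval_hom_component
    by (simp only: poly_eval_def sum_divide_distrib of_real_eq_id id_apply, intro tendsto_sum summand)
  moreover have "(\<lambda>k. a k $ i / r k ^ ?d) \<longlonglongrightarrow> 0"
  proof -
    have "(\<lambda>k. a k $ i * inverse (r k) ^ ?d) \<longlonglongrightarrow> (0 :: real ^ 'n) $ i * 0 ^ ?d"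
      by (intro tendsto_intros a rinv)
    then show ?thesis by (simp add: divide_inverse power_inverse)
  qed
  ultimately have "(\<lambda>k. poly_eval ?p (r k *\<^sub>R u k) / r k ^ ?d + a k $ i / r k ^ ?d) \<longlonglongrightarrow>
      poly_eval (hom_component ?d ?p) v + 0"
    by (rule tendsto_add)
  then show "(\<lambda>k. ((map_eval f (r k *\<^sub>R u k) + a k) /\<^sub>R r k ^ ?d) $ i) \<longlonglongrightarrow>
      map_eval (leading_map f) v $ i"
    by (simp add: map_eval_def leading_map_def field_simps)
qed

text \<open>
  Copositivity is inherited along every ray \<open>k v\<close>, in the limit of the rescaled values.
\<close>

lemma copositive_leading_map:
  assumes "copositive f"
  shows "copositive (leading_map f)"
  unfolding copositive_def
proof
  fix v :: "real ^ 'a" assume v: "v \<in> nonneg_orthant"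
  let ?d = "map_degree f"
  have "(\<lambda>k. v \<bullet> ((map_eval f (real k *\<^sub>R v) + 0) /\<^sub>R real k ^ ?d)) \<longlonglongrightarrow>
      v \<bullet> map_eval (leading_map f) v"
    by (intro tendsto_inner tendsto_const map_eval_rescaled_tendsto_leading_map
        filterlim_real_sequentially)
  moreover have "0 \<le> v \<bullet> ((map_eval f (real k *\<^sub>R v) + 0) /\<^sub>R real k ^ ?d)" if "k \<ge> 1" for k
  proof -
    have "real k *\<^sub>R v \<in> nonneg_orthant" using v by (simp add: nonneg_orthant_def)
    then have "0 \<le> (real k *\<^sub>R v) \<bullet> map_eval f (real k *\<^sub>R v)"
      using assms unfolding copositive_def by blast
    then have "0 \<le> v \<bullet> map_eval f (real k *\<^sub>R v)"
      using that by (simp add: zero_le_mult_iff)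
    then show ?thesis by simp
  qed
  ultimately show "0 \<le> v \<bullet> map_eval (leading_map f) v"
    using LIMSEQ_le_const by blast
qed

section \<open>Complementarity on truncated orthants\<close>

definition truncated_orthant :: "real \<Rightarrow> (real ^ 'n::finite) set" where
  "truncated_orthant r = {x \<in> nonneg_orthant. (\<Sum>i\<in>UNIV. x $ i) \<le> r}"

lemma closed_nonneg_orthant: "closed (nonneg_orthant :: (real ^ 'n::finite) set)"
  unfolding nonneg_orthant_def
  by (intro closed_Collect_all allI closed_Collect_le continuous_intros)

lemma compact_truncated_orthant: "compact (truncated_orthant r :: (real ^ 'n::finite) set)"
proof -
  have "truncated_orthant r = nonneg_orthant \<inter> {x :: real ^ 'n. (\<Sum>i\<in>UNIV. x $ i) \<le> r}"
    by (auto simp: truncated_orthant_def)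
  moreover have "closed {x :: real ^ 'n. (\<Sum>i\<in>UNIV. x $ i) \<le> r}"
    by (intro closed_Collect_le continuous_intros)
  ultimately have "closed (truncated_orthant r :: (real ^ 'n) set)"
    by (simp add: closed_Int closed_nonneg_orthant)
  moreover have "norm x \<le> r" if "x \<in> truncated_orthant r" for x :: "real ^ 'n"
  proof -
    have "norm x \<le> (\<Sum>i\<in>UNIV. \<bar>x $ i\<bar>)" by (rule norm_le_l1_cart)
    also have "\<dots> = (\<Sum>i\<in>UNIV. x $ i)"
      using that by (intro sum.cong) (auto simp: truncated_orthant_def nonneg_orthant_def)
    also have "\<dots> \<le> r" using that by (simp add: truncated_orthant_def)
    finally show ?thesis .
  qed
  then have "bounded (truncated_orthant r :: (real ^ 'n) set)" by (rule boundedI)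
  ultimately show ?thesis by (simp add: compact_eq_bounded_closed)
qed

lemma convex_truncated_orthant: "convex (truncated_orthant r :: (real ^ 'n::finite) set)"
proof (rule convexI)
  fix x y :: "real ^ 'n" and s t :: real
  assume x: "x \<in> truncated_orthant r" and y: "y \<in> truncated_orthant r" and st: "0 \<le> s" "0 \<le> t" "s + t = 1"
  have "(\<Sum>i\<in>UNIV. (s *\<^sub>R x + t *\<^sub>R y) $ i) = s * (\<Sum>i\<in>UNIV. x $ i) + t * (\<Sum>i\<in>UNIV. y $ i)"
    by (simp add: sum.distrib sum_distrib_left)
  also have "\<dots> \<le> s * r + t * r"
    using x y st by (intro add_mono mult_left_mono) (auto simp: truncated_orthant_def)
  also have "\<dots> = r" using st by (simp flip: distrib_right)
  finally show "s *\<^sub>R x + t *\<^sub>R y \<in> truncated_orthant r"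
    using x y st by (simp add: truncated_orthant_def nonneg_orthant_def)
qed

text \<open>
  By Brouwer's theorem the map \<open>x \<mapsto> proj\<^sub>K (x - F x)\<close> has a fixed point, and the variational
  inequality is the obtuse angle property of the projection at it.
\<close>

lemma variational_inequality_solvable:
  fixes F :: "'a::euclidean_space \<Rightarrow> 'a"
  assumes "compact K" "convex K" "K \<noteq> {}" and F: "continuous_on K F"
  shows "\<exists>x\<in>K. \<forall>y\<in>K. 0 \<le> F x \<bullet> (y - x)"
proof -
  have K: "closed K" using assms by (simp add: compact_imp_closed)
  have cont: "continuous_on K (\<lambda>x. closest_point K (x - F x))"
    by (rule continuous_on_compose2[OF continuous_on_closest_point[of K UNIV]])
       (use assms K in \<open>auto intro!: continuous_intros\<close>)
  have maps: "(\<lambda>x. closest_point K (x - F x)) \<in> K \<rightarrow> K"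
    using K assms by (auto intro!: closest_point_in_set)
  obtain x where x: "x \<in> K" "closest_point K (x - F x) = x"
    by (rule brouwer[OF assms(1-3) cont maps])
  have "0 \<le> F x \<bullet> (y - x)" if "y \<in> K" for y
    using closest_point_dot[OF assms(2) K that, of "x - F x"] x(2)
    by (simp add: inner_diff_left)
  then show ?thesis using x(1) by blast
qed

text \<open>
  The optimality conditions for the variational inequality on the truncated orthant: \<open>\<tau>\<close> is the
  multiplier of the truncating constraint. It vanishes where this constraint is inactive, and then
  \<open>x\<close> solves the complementarity problem itself. Only the test points \<open>0\<close>, \<open>r e\<^sub>i\<close> and
  \<open>x + t e\<^sub>i\<close> enter.
\<close>

lemma truncated_complementarity_solvable:
  fixes F :: "real ^ 'n::finite \<Rightarrow> real ^ 'n"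
  assumes F: "continuous_on UNIV F" and r: "0 < r"
  obtains x \<tau> where "x \<in> truncated_orthant r" "0 \<le> \<tau>" "\<And>i. 0 \<le> F x $ i + \<tau>"
    "x \<bullet> F x + \<tau> * (\<Sum>i\<in>UNIV. x $ i) = 0" "(\<Sum>i\<in>UNIV. x $ i) < r \<Longrightarrow> \<tau> = 0"
proof -
  let ?s = "\<lambda>x :: real ^ 'n. \<Sum>i\<in>UNIV. x $ i"
  have zero: "0 \<in> (truncated_orthant r :: (real ^ 'n) set)"
    using r by (simp add: truncated_orthant_def nonneg_orthant_def)
  obtain x where x: "x \<in> truncated_orthant r" and vi: "\<And>y. y \<in> truncated_orthant r \<Longrightarrow> 0 \<le> F x \<bullet> (y - x)"
    using variational_inequality_solvable[OF compact_truncated_orthant convex_truncated_orthant _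
        continuous_on_subset[OF F subset_UNIV], of r] zero by blast
  have xF: "x \<bullet> F x \<le> 0"
    using vi[OF zero] by (simp add: inner_commute)
  have axis_sum: "?s (axis i t) = t" for i t
    by (simp add: axis_def)
  show thesis
  proof (cases "?s x < r")
    case True
    have Fi: "0 \<le> F x $ i" for i
    proof -
      let ?t = "r - ?s x"
      have "x + axis i ?t \<in> truncated_orthant r"
        using x True by (auto simp: truncated_orthant_def nonneg_orthant_def sum.distrib axis_sum)
           (auto simp: axis_def)
      from vi[OF this] have "0 \<le> F x $ i * ?t"
        by (simp add: inner_axis)
      then show ?thesis using True by (simp add: zero_le_mult_iff)
    qed
    have "0 \<le> x \<bullet> F x"
      unfolding inner_vec_def using x Fi
      by (auto intro!: sum_nonneg simp: truncated_orthant_def nonneg_orthant_def)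
    then show thesis using x xF Fi by (intro that[of x 0]) auto
  next
    case False
    then have sx: "?s x = r" using x by (auto simp: truncated_orthant_def)
    define \<tau> where "\<tau> = - (x \<bullet> F x) / r"
    have "0 \<le> F x $ i + \<tau>" for i
    proof -
      have "axis i r \<in> truncated_orthant r"
        using r by (auto simp: truncated_orthant_def nonneg_orthant_def axis_sum) (auto simp: axis_def)
      from vi[OF this] have "x \<bullet> F x \<le> F x $ i * r"
        by (simp add: inner_axis inner_diff_right inner_commute)
      then show ?thesis using r by (simp add: \<tau>_def field_simps)
    qed
    moreover have "0 \<le> \<tau>" using xF r by (simp add: \<tau>_def divide_nonpos_pos)
    moreover have "x \<bullet> F x + \<tau> * ?s x = 0" using r by (simp add: \<tau>_def sx)
    ultimately show thesis using x False by (intro that[of x \<tau>]) auto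
  qed
qed

text \<open>
  Otherwise there are solutions with \<open>r = \<Sum>x\<^sub>i\<close> tending to infinity and perturbations tending to
  zero. Let \<open>v\<close> be a limit point of the normalised solutions \<open>u = x / r\<close>. Divided by the power
  \<open>r\<^sup>d\<close>, the multipliers are nonnegative and tend to \<open>-\<langle>v | f\<^sup>\<infinity>(v)\<rangle>\<close>, which is at most zero by
  copositivity. So they tend to zero, and \<open>v\<close> solves the problem for \<open>f\<^sup>\<infinity>\<close> although its
  coordinates add up to one. With multiplier zero the bound concerns the actual solutions of the
  perturbed problems; with a positive one it excludes solutions that stick to the truncation.
\<close>

lemma perturbed_multiplier_solutions_bounded:
  fixes f :: "('n::finite) polymap"
  assumes copos: "copositive (leading_map f)" and sol: "Sol (leading_map f) = {0}"
  shows "\<exists>R>0. \<exists>\<epsilon>>0. \<forall>a x \<tau>. norm a < \<epsilon> \<longrightarrow> x \<in> nonneg_orthant \<longrightarrow> 0 \<le> \<tau> \<longrightarrow>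
     (\<forall>i. 0 \<le> (map_eval f x + a) $ i + \<tau>) \<longrightarrow>
     x \<bullet> (map_eval f x + a) + \<tau> * (\<Sum>i\<in>UNIV. x $ i) = 0 \<longrightarrow> (\<Sum>i\<in>UNIV. x $ i) \<le> R"
proof (rule ccontr)
  let ?s = "\<lambda>x :: real ^ 'n. \<Sum>i\<in>UNIV. x $ i"
  let ?d = "map_degree f"
  let ?bad = "\<lambda>R \<epsilon> a x \<tau>. norm a < \<epsilon> \<and> x \<in> nonneg_orthant \<and> 0 \<le> \<tau> \<and>
     (\<forall>i. 0 \<le> (map_eval f x + a) $ i + \<tau>) \<and> x \<bullet> (map_eval f x + a) + \<tau> * ?s x = 0 \<and> R < ?s x"
  assume "\<not> ?thesis"
  then have "\<forall>R>0. \<forall>\<epsilon>>0. \<exists>a x \<tau>. ?bad R \<epsilon> a x \<tau>"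
    by (simp only: not_ex not_all not_imp de_Morgan_conj not_le) blast
  then have "\<forall>k. \<exists>a x \<tau>. ?bad (real (Suc k)) (inverse (real (Suc k))) a x \<tau>"
    by simp
  then obtain a x \<tau> where bad: "\<And>k. ?bad (real (Suc k)) (inverse (real (Suc k))) (a k) (x k) (\<tau> k)"
    by metis
  define r where "r k = ?s (x k)" for k
  define u where "u k = x k /\<^sub>R r k" for k
  have r: "real (Suc k) < r k" for k using bad[of k] by (simp add: r_def)
  have r0: "0 < r k" for k using r[of k] by simp
  have a: "a \<longlonglongrightarrow> 0"
  proof (rule Lim_null_comparison)
    show "\<forall>\<^sub>F k in sequentially. norm (a k) \<le> inverse (real (Suc k))"
      using bad by (intro always_eventually allI less_imp_le) blast
  qed (rule LIMSEQ_inverse_real_of_nat)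
  have rge: "real k \<le> r k" for k using r[of k] by simp
  have rtop: "filterlim r at_top sequentially"
    by (rule filterlim_at_top_mono[OF filterlim_real_sequentially])
       (intro always_eventually allI rge)
  have su: "?s (u k) = 1" for k
    using r0[of k] by (simp add: u_def r_def flip: sum_distrib_left)
  have u: "u k \<in> truncated_orthant 1" for k
    using bad[of k] r0[of k] su[of k] by (auto simp: truncated_orthant_def nonneg_orthant_def u_def)
  have "\<exists>v\<in>truncated_orthant 1. \<exists>\<sigma>. strict_mono \<sigma> \<and> (u \<circ> \<sigma>) \<longlonglongrightarrow> v"
    using compact_truncated_orthant[of 1, unfolded compact_def] u by blast
  then obtain v \<sigma> where v: "v \<in> truncated_orthant 1" "strict_mono \<sigma>" "(u \<circ> \<sigma>) \<longlonglongrightarrow> v"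
    by blast
  let ?G = "\<lambda>k. (map_eval f (r (\<sigma> k) *\<^sub>R u (\<sigma> k)) + a (\<sigma> k)) /\<^sub>R r (\<sigma> k) ^ ?d"
  have G: "?G \<longlonglongrightarrow> map_eval (leading_map f) v"
    using map_eval_rescaled_tendsto_leading_map[of "r \<circ> \<sigma>" "u \<circ> \<sigma>" v "a \<circ> \<sigma>" f] v
      filterlim_compose[OF rtop filterlim_subseq[OF v(2)]] LIMSEQ_subseq_LIMSEQ[OF a v(2)]
    by (simp add: comp_def)
  define \<nu> where "\<nu> k = \<tau> (\<sigma> k) / r (\<sigma> k) ^ ?d" for k
  have x: "r k *\<^sub>R u k = x k" for k using r0[of k] by (simp add: u_def)
  have \<nu>: "\<nu> k = - (u (\<sigma> k) \<bullet> ?G k)" for k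
  proof -
    let ?k = "\<sigma> k"
    have "u ?k \<bullet> (map_eval f (x ?k) + a ?k) = - \<tau> ?k"
    proof -
      have "r ?k * (u ?k \<bullet> (map_eval f (x ?k) + a ?k)) = x ?k \<bullet> (map_eval f (x ?k) + a ?k)"
        by (metis x inner_scaleR_left)
      also have "\<dots> = - (\<tau> ?k * ?s (x ?k))"
        using bad[of ?k] by (intro eq_neg_iff_add_eq_0[THEN iffD2]) blast
      also have "\<dots> = r ?k * (- \<tau> ?k)" by (simp add: r_def)
      finally show ?thesis using r0[of ?k] by (simp only: mult_cancel_left) simp
    qed
    then have "u ?k \<bullet> ?G k = inverse (r ?k ^ ?d) * (- \<tau> ?k)"
      by (simp only: x inner_scaleR_right)
    then show ?thesis by (simp add: \<nu>_def divide_inverse)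
  qed
  have \<nu>0: "0 \<le> \<nu> k" for k using bad[of "\<sigma> k"] r0[of "\<sigma> k"] by (simp add: \<nu>_def)
  have "\<nu> \<longlonglongrightarrow> - (v \<bullet> map_eval (leading_map f) v)"
    unfolding \<nu> using v(3) by (intro tendsto_intros G) (simp add: comp_def)
  moreover have v0: "v \<in> nonneg_orthant" using v(1) by (simp add: truncated_orthant_def)
  then have "0 \<le> v \<bullet> map_eval (leading_map f) v" using copos by (simp add: copositive_def)
  moreover have "0 \<le> - (v \<bullet> map_eval (leading_map f) v)"
    using calculation(1) \<nu>0 by (intro LIMSEQ_le_const) auto
  ultimately have vG: "v \<bullet> map_eval (leading_map f) v = 0" and \<nu>lim: "\<nu> \<longlonglongrightarrow> 0" by auto
  have "0 \<le> map_eval (leading_map f) v $ i" for i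
  proof -
    have "(\<lambda>k. ?G k $ i + \<nu> k) \<longlonglongrightarrow> map_eval (leading_map f) v $ i + 0"
      by (intro tendsto_intros G \<nu>lim)
    moreover have "0 \<le> ?G k $ i + \<nu> k" for k
    proof -
      have "0 \<le> (map_eval f (x (\<sigma> k)) + a (\<sigma> k)) $ i + \<tau> (\<sigma> k)" using bad[of "\<sigma> k"] by blast
      then have "0 \<le> ((map_eval f (x (\<sigma> k)) + a (\<sigma> k)) $ i + \<tau> (\<sigma> k)) / r (\<sigma> k) ^ ?d"
        using r0[of "\<sigma> k"] by simp
      then show ?thesis by (simp add: x \<nu>_def add_divide_distrib divide_inverse algebra_simps)
    qed
    ultimately show ?thesis
      by (metis (no_types, lifting) LIMSEQ_le_const add.right_neutral)
  qed
  then have "v \<in> Sol (leading_map f)"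
    using v0 vG by (simp add: Sol_def nonneg_orthant_def)
  then have "v = 0" using sol by simp
  moreover have "?s v = 1"
  proof -
    have "(\<lambda>k. ?s ((u \<circ> \<sigma>) k)) \<longlonglongrightarrow> ?s v"
      by (intro tendsto_intros v(3))
    then show ?thesis using su by (simp add: LIMSEQ_const_iff)
  qed
  ultimately show False by simp
qed

section \<open>Stability of the solution set\<close>

lemma map_eval_translated:
  "map_eval (f + const_map a) x = map_eval f x + a" for x :: "real ^ 'n::finite"
  by (simp add: vec_eq_iff map_eval_add_const)

lemma Sol_translated_limit:
  fixes f :: "('n::finite) polymap"
  assumes "\<And>k. x k \<in> Sol (f + const_map (a k))" and x: "x \<longlonglongrightarrow> v" and a: "a \<longlonglongrightarrow> 0"
  shows "v \<in> Sol f"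
proof -
  have k: "x k \<in> nonneg_orthant" "map_eval f (x k) + a k \<in> nonneg_orthant"
    "x k \<bullet> (map_eval f (x k) + a k) = 0" for k
    using assms(1)[of k] by (auto simp: Sol_def map_eval_translated)
  have "(\<lambda>k. map_eval f (x k)) \<longlonglongrightarrow> map_eval f v"
    using continuous_on_map_eval[of UNIV f] x
    by (auto simp: continuous_on_eq_continuous_at intro: isCont_tendsto_compose)
  then have F: "(\<lambda>k. map_eval f (x k) + a k) \<longlonglongrightarrow> map_eval f v"
    using tendsto_add[OF _ a] by fastforce
  have "v \<in> nonneg_orthant"
    using closed_nonneg_orthant k(1) x by (rule closed_sequentially)
  moreover have "map_eval f v \<in> nonneg_orthant"
    using closed_nonneg_orthant k(2) F by (rule closed_sequentially)
  moreover have "v \<bullet> map_eval f v = 0"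
    using tendsto_inner[OF x F] k(3) by (simp add: LIMSEQ_const_iff)
  ultimately show ?thesis by (simp add: Sol_def)
qed

text \<open>
  On the orthant truncated at \<open>R + 1\<close> the truncating constraint is never active, because the sum of
  the coordinates is at most \<open>R\<close>; so the solution found there has multiplier zero.
\<close>

lemma Sol_translated_nonempty_and_bounded:
  fixes f :: "('n::finite) polymap"
  assumes copos: "copositive (leading_map f)" and sol: "Sol (leading_map f) = {0}"
  shows "\<exists>R. \<exists>\<epsilon>>0. \<forall>a. norm a < \<epsilon> \<longrightarrow>
     Sol (f + const_map a) \<noteq> {} \<and> Sol (f + const_map a) \<subseteq> truncated_orthant R"
proof -
  let ?s = "\<lambda>x :: real ^ 'n. \<Sum>i\<in>UNIV. x $ i"
  obtain R \<epsilon> where R: "0 < R" "0 < \<epsilon>"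
    and bound: "\<And>a x \<tau>. norm a < \<epsilon> \<Longrightarrow> x \<in> nonneg_orthant \<Longrightarrow> 0 \<le> \<tau> \<Longrightarrow>
     (\<And>i. 0 \<le> (map_eval f x + a) $ i + \<tau>) \<Longrightarrow>
     x \<bullet> (map_eval f x + a) + \<tau> * ?s x = 0 \<Longrightarrow> ?s x \<le> R"
    using perturbed_multiplier_solutions_bounded[OF assms] by meson
  have "Sol (f + const_map a) \<noteq> {} \<and> Sol (f + const_map a) \<subseteq> truncated_orthant R"
    if a: "norm a < \<epsilon>" for a
  proof
    have cont: "continuous_on UNIV (\<lambda>x. map_eval f x + a)"
      by (intro continuous_intros continuous_on_map_eval)
    have R1: "0 < R + 1" using R by simp
    obtain x \<tau> where x: "x \<in> truncated_orthant (R + 1)" "0 \<le> \<tau>" "\<And>i. 0 \<le> (map_eval f x + a) $ i + \<tau>"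
      "x \<bullet> (map_eval f x + a) + \<tau> * ?s x = 0" "?s x < R + 1 \<Longrightarrow> \<tau> = 0"
      using truncated_complementarity_solvable[OF cont R1] by metis
    have "x \<in> nonneg_orthant" using x(1) by (simp add: truncated_orthant_def)
    moreover from bound[OF a this x(2-4)] have "\<tau> = 0" using x(5) by simp
    ultimately have "x \<in> Sol (f + const_map a)"
      using x(3,4) by (simp add: Sol_def map_eval_translated nonneg_orthant_def)
    then show "Sol (f + const_map a) \<noteq> {}" by blast
    show "Sol (f + const_map a) \<subseteq> truncated_orthant R"
    proof
      fix x assume "x \<in> Sol (f + const_map a)"
      then have "x \<in> nonneg_orthant" "map_eval f x + a \<in> nonneg_orthant" "x \<bullet> (map_eval f x + a) = 0"
        by (auto simp: Sol_def map_eval_translated)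
      moreover from this have "?s x \<le> R"
        by (intro bound[OF a, of x 0]) (auto simp: nonneg_orthant_def)
      ultimately show "x \<in> truncated_orthant R" by (simp add: truncated_orthant_def)
    qed
  qed
  then show ?thesis using R(2) by blast
qed

text \<open>
  The graph of the solution sets is closed at the perturbation zero, so solutions that stay in a
  compact set can only accumulate at \<open>Sol f\<close>.
\<close>

lemma Sol_translated_upper_semicontinuous:
  fixes f :: "('n::finite) polymap"
  assumes K: "compact K" and \<epsilon>: "0 < \<epsilon>"
    and sub: "\<And>a. norm a < \<epsilon> \<Longrightarrow> Sol (f + const_map a) \<subseteq> K" and \<mu>: "0 < \<mu>"
  shows "\<exists>\<delta>>0. \<forall>a. norm a < \<delta> \<longrightarrow> Sol (f + const_map a) \<subseteq> Sol f + ball 0 \<mu>"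
proof (rule ccontr)
  assume "\<not> ?thesis"
  then have *: "\<exists>a. norm a < \<delta> \<and> (\<exists>x. x \<in> Sol (f + const_map a) \<and> x \<notin> Sol f + ball 0 \<mu>)"
    if "0 < \<delta>" for \<delta>
    using that by blast
  have "\<forall>k. \<exists>a x. norm a < min \<epsilon> (inverse (real (Suc k))) \<and>
      x \<in> Sol (f + const_map a) \<and> x \<notin> Sol f + ball 0 \<mu>"
    using *[of "min \<epsilon> (inverse (real (Suc _)))"] \<epsilon> by force
  then obtain a x where ax: "\<And>k. norm (a k) < min \<epsilon> (inverse (real (Suc k)))"
      "\<And>k. x k \<in> Sol (f + const_map (a k))" "\<And>k. x k \<notin> Sol f + ball 0 \<mu>"
    by metis
  have a: "a \<longlonglongrightarrow> 0"
  proof (rule Lim_null_comparison)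
    show "\<forall>\<^sub>F k in sequentially. norm (a k) \<le> inverse (real (Suc k))"
      using ax(1) by (intro always_eventually allI less_imp_le) (simp only: min_less_iff_conj)
  qed (rule LIMSEQ_inverse_real_of_nat)
  have "x k \<in> K" for k using sub[of "a k"] ax(1,2)[of k] by auto
  then have "\<exists>v\<in>K. \<exists>\<sigma>. strict_mono \<sigma> \<and> (x \<circ> \<sigma>) \<longlonglongrightarrow> v"
    using K[unfolded compact_def] by blast
  then obtain v \<sigma> where v: "strict_mono \<sigma>" "(x \<circ> \<sigma>) \<longlonglongrightarrow> v" by blast
  have "v \<in> Sol f"
    using ax(2) v(2) LIMSEQ_subseq_LIMSEQ[OF a v(1)]
    by (intro Sol_translated_limit[of "x \<circ> \<sigma>" f "a \<circ> \<sigma>"]) auto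
  moreover obtain k where "dist ((x \<circ> \<sigma>) k) v < \<mu>"
    using tendstoD[OF v(2) \<mu>] by (auto simp: eventually_sequentially)
  then have "x (\<sigma> k) - v \<in> ball 0 \<mu>" by (simp add: dist_norm norm_minus_commute)
  ultimately have "v + (x (\<sigma> k) - v) \<in> Sol f + ball 0 \<mu>" by (rule set_plus_intro)
  then show False using ax(3)[of "\<sigma> k"] by simp
qed

theorem proposition7p1:
  fixes f :: "('n::finite) polymap"
  assumes copos: "copositive f \<or> copositive (leading_map f)"
    and sol_inf: "Sol (leading_map f) = {0}"
  shows "(\<exists>A :: (real ^ 'n) set. generic A \<and> (\<forall>a\<in>A. D0 (f + const_map a))) \<and>
         (\<forall>\<mu>>0. \<exists>\<epsilon>>0. \<forall>a :: real ^ 'n. norm a < \<epsilon> \<longrightarrow>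
            Sol (f + const_map a) \<noteq> {} \<and> Sol (f + const_map a) \<subseteq> Sol f + ball 0 \<mu>)"
proof (intro conjI allI impI)
  show "\<exists>A :: (real ^ 'n) set. generic A \<and> (\<forall>a\<in>A. D0 (f + const_map a))"
    by (rule generic_translation_D0)
next
  fix \<mu> :: real assume \<mu>: "0 < \<mu>"
  have "copositive (leading_map f)" using copos copositive_leading_map by blast
  then obtain R \<epsilon> where \<epsilon>: "0 < \<epsilon>"
    and R: "\<And>a. norm a < \<epsilon> \<Longrightarrow> Sol (f + const_map a) \<noteq> {} \<and> Sol (f + const_map a) \<subseteq> truncated_orthant R"
    using Sol_translated_nonempty_and_bounded[OF _ sol_inf] by blast
  have "\<And>a. norm a < \<epsilon> \<Longrightarrow> Sol (f + const_map a) \<subseteq> truncated_orthant R" using R by blast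
  from Sol_translated_upper_semicontinuous[OF compact_truncated_orthant \<epsilon> this \<mu>]
  obtain \<delta> where \<delta>: "0 < \<delta>" "\<forall>a. norm a < \<delta> \<longrightarrow> Sol (f + const_map a) \<subseteq> Sol f + ball 0 \<mu>"
    by blast
  show "\<exists>\<epsilon>>0. \<forall>a :: real ^ 'n. norm a < \<epsilon> \<longrightarrow>
      Sol (f + const_map a) \<noteq> {} \<and> Sol (f + const_map a) \<subseteq> Sol f + ball 0 \<mu>"
    using \<epsilon> \<delta> R by (intro exI[of _ "min \<epsilon> \<delta>"]) auto
qed

end
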